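(* Let $\Omega$ be a domain in $\mathbb{C}^n$ and let $p\in\partial\Omega$ be a $w$-point. Then for any neighbourhood $U$ of $p$ we have $$\lim_{z,w\to p}\frac{k_{\Omega\cap U}(z,w)}{k_\Omega(z,w)}=1,$$ where the limit is taken over pairs $z\neq w$ of points lying in the same connected component of $\Omega\cap U$.
   Context: A domain is a non-empty connected open set; $\Delta\subset\mathbb{C}$ is the unit disc and $\mathcal{O}(\Delta,\Omega)$ is the set of holomorphic maps $\Delta\to\Omega$. The Lempert function of a domain $\Omega$ is $l_\Omega(z,w):=\tanh^{-1}\tilde l_\Omega(z,w)$, where $\tilde l_\Omega(z,w):=\inf\{|\alpha|:\alpha\in\Delta,\ \exists\varphi\in\mathcal{O}(\Delta,\Omega)\text{ with }\varphi(0)=z,\ \varphi(\alpha)=w\}$. The Kobayashi distance $k_\Omega$ is the largest pseudodistance on $\Omega$ not exceeding $l_\Omega$. If $\Omega\cap U$ is not connected and $z,w$ lie in the same connected component $D$ of $\Omega\cap U$, then $k_{\Omega\cap U}(z,w)$ means $k_D(z,w)$. The Gromov product is $(z|w)^\Omega_o=\frac12\left(k_\Omega(z,o)+k_\Omega(w,o)-k_\Omega(z,w)\right)$ for $z,w,o\in\Omega$. A point $p\in\partial\Omega$ is a $w$-point if for any neighbourhood $U$ of $p$ such that $\Omega\setminus U$ is non-empty, $$\lim_{z,w\to p}\Big(\inf_{o\in\Omega\setminus U}(z|w)^\Omega_o\Big)=\infty$$ (here $z,w\in\Omega$). Under the assumption that $p$ is a $w$-point, $k_\Omega(z,w)>0$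 for all $z\ne w$ in $\Omega$ sufficiently close to $p$, so the quotient is well defined near $p$. *)

theory Defs
  imports "HOL-Complex_Analysis.Complex_Analysis"
begin

definition is_domain :: "'a::topological_space set \<Rightarrow> bool" where
  "is_domain \<Omega> \<longleftrightarrow> open \<Omega> \<and> connected \<Omega> \<and> \<Omega> \<noteq> {}"

text \<open>Maps from the unit disc into \<open>\<Omega>\<close>; such a map is holomorphic iff each of its coordinates is.\<close>

definition holo_discs :: "(complex ^ 'n) set \<Rightarrow> (complex \<Rightarrow> complex ^ 'n) set" where
  "holo_discs \<Omega> =
     {\<phi>. (\<forall>i. (\<lambda>\<zeta>. \<phi> \<zeta> $ i) holomorphic_on ball 0 1) \<and> \<phi> ` ball 0 1 \<subseteq> \<Omega>}"

text \<open>For points of a domain the set below is non-empty and contained in \<open>[0,1)\<close>, so the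
  infimum is a genuine one and lies in the range on which \<open>artanh\<close> is meaningful.\<close>

definition lempert_tilde :: "(complex ^ 'n) set \<Rightarrow> complex ^ 'n \<Rightarrow> complex ^ 'n \<Rightarrow> real" where
  "lempert_tilde \<Omega> z w =
     Inf {cmod \<alpha> |\<alpha>. \<alpha> \<in> ball 0 1 \<and> (\<exists>\<phi>\<in>holo_discs \<Omega>. \<phi> 0 = z \<and> \<phi> \<alpha> = w)}"

definition lempert :: "(complex ^ 'n) set \<Rightarrow> complex ^ 'n \<Rightarrow> complex ^ 'n \<Rightarrow> real" where
  "lempert \<Omega> z w = artanh (lempert_tilde \<Omega> z w)"

definition pseudodistance_on :: "'a set \<Rightarrow> ('a \<Rightarrow> 'a \<Rightarrow> real) \<Rightarrow> bool" where
  "pseudodistance_on S d \<longleftrightarrow>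
     (\<forall>x\<in>S. d x x = 0) \<and>
     (\<forall>x\<in>S. \<forall>y\<in>S. 0 \<le> d x y \<and> d x y = d y x) \<and>
     (\<forall>x\<in>S. \<forall>y\<in>S. \<forall>z\<in>S. d x z \<le> d x y + d y z)"

definition largest_pseudodistance_below ::
    "'a set \<Rightarrow> ('a \<Rightarrow> 'a \<Rightarrow> real) \<Rightarrow> ('a \<Rightarrow> 'a \<Rightarrow> real) \<Rightarrow> bool" where
  "largest_pseudodistance_below S l k \<longleftrightarrow>
     pseudodistance_on S k \<and> (\<forall>x\<in>S. \<forall>y\<in>S. k x y \<le> l x y) \<and>
     (\<forall>d. pseudodistance_on S d \<and> (\<forall>x\<in>S. \<forall>y\<in>S. d x y \<le> l x y) \<longrightarrow>
          (\<forall>x\<in>S. \<forall>y\<in>S. d x y \<le> k x y))"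

text \<open>The choice is unique on \<open>\<Omega> \<times> \<Omega>\<close>; only the irrelevant values off \<open>\<Omega> \<times> \<Omega>\<close> are arbitrary.\<close>

definition kobayashi :: "(complex ^ 'n) set \<Rightarrow> complex ^ 'n \<Rightarrow> complex ^ 'n \<Rightarrow> real" where
  "kobayashi \<Omega> = (SOME k. largest_pseudodistance_below \<Omega> (lempert \<Omega>) k)"

text \<open>For open sets that need not be connected: the Kobayashi distance of the component
  containing \<open>z\<close>, meaningful when \<open>w\<close> lies in the same component. On connected \<open>S\<close> this is
  \<open>kobayashi S\<close>.\<close>

definition kobayashi_comp :: "(complex ^ 'n) set \<Rightarrow> complex ^ 'n \<Rightarrow> complex ^ 'n \<Rightarrow> real" where
  "kobayashi_comp S z w = kobayashi (connected_component_set S z) z w"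

definition gromov_product ::
    "(complex ^ 'n) set \<Rightarrow> complex ^ 'n \<Rightarrow> complex ^ 'n \<Rightarrow> complex ^ 'n \<Rightarrow> real" where
  "gromov_product \<Omega> b z w =
     (kobayashi \<Omega> z b + kobayashi \<Omega> w b - kobayashi \<Omega> z w) / 2"

text \<open>The infimum ranges over a non-empty set of numbers that is bounded below by 0,
  by the triangle inequality.\<close>

definition w_point :: "(complex ^ 'n) set \<Rightarrow> complex ^ 'n \<Rightarrow> bool" where
  "w_point \<Omega> p \<longleftrightarrow> p \<in> frontier \<Omega> \<and>
     (\<forall>U. open U \<and> p \<in> U \<and> \<Omega> - U \<noteq> {} \<longrightarrow>
        filterlim (\<lambda>(z, w). INF b\<in>\<Omega> - U. gromov_product \<Omega> b z w) at_top
          (at (p, p) within \<Omega> \<times> \<Omega>))"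

end

theory Submission imports Defs begin

text \<open>\<open>k\<^sub>\<Omega>(z,w)\<close> is the infimum of the lengths of chains of analytic discs, and since a disc can be
  subdivided along a hyperbolic geodesic, the links may be taken arbitrarily short. If all Gromov
  products \<open>(z|w)\<^sub>b\<close> with \<open>b \<in> \<Omega> - U\<close> exceed \<open>R\<close>, every vertex of an almost minimal chain has Kobayashi
  distance at least about \<open>R\<close> from \<open>\<Omega> - U\<close>. A disc centred at such a vertex, restricted to radius
  \<open>tanh R\<close>, stays in \<open>U\<close>, so in \<open>\<Omega> \<inter> U\<close> a short link grows at most by a factor close to \<open>coth R\<close>.
  Hence \<open>k\<^sub>\<Omega> \<le> k\<^bsub>\<Omega>\<inter>U\<^esub> \<le> C k\<^sub>\<Omega>\<close> near \<open>p\<close> for every \<open>C > 1\<close>. The same estimate for a bounded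
  neighbourhood, with the Schwarz lemma, makes \<open>k\<^sub>\<Omega>\<close> positive near \<open>p\<close>.\<close>

unbundle no Formal_Power_Series.fps_syntax

section \<open>Discs through two points, measured by hyperbolic length\<close>

text \<open>The number \<open>s\<close> is the hyperbolic distance from 0 to \<open>tanh s\<close>,
  so lengths add along the real diameter of the disc.\<close>

definition disc_joins :: "(complex ^ 'n) set \<Rightarrow> real \<Rightarrow> complex ^ 'n \<Rightarrow> complex ^ 'n \<Rightarrow> bool" where
  "disc_joins \<Omega> s x y \<longleftrightarrow>
     0 \<le> s \<and> (\<exists>\<phi>\<in>holo_discs \<Omega>. \<phi> 0 = x \<and> \<phi> (of_real (tanh s)) = y)"

lemma holo_discs_compose:
  assumes \<phi>: "\<phi> \<in> holo_discs \<Omega>" and h: "h holomorphic_on ball 0 1" "h ` ball 0 1 \<subseteq> ball 0 1"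
  shows "(\<lambda>\<zeta>. \<phi> (h \<zeta>)) \<in> holo_discs \<Omega>"
proof -
  have "(\<lambda>\<zeta>. \<phi> (h \<zeta>) $ i) holomorphic_on ball 0 1" for i
    using holomorphic_on_compose_gen[OF h(1), of "\<lambda>\<zeta>. \<phi> \<zeta> $ i" "ball 0 1"] \<phi> h(2)
    by (auto simp: holo_discs_def o_def)
  then show ?thesis
    using \<phi> h(2) unfolding holo_discs_def by blast
qed

lemma holo_discs_in: "\<phi> \<in> holo_discs \<Omega> \<Longrightarrow> cmod \<zeta> < 1 \<Longrightarrow> \<phi> \<zeta> \<in> \<Omega>"
  by (auto simp: holo_discs_def)

lemma disc_joins_in: "disc_joins \<Omega> s x y \<Longrightarrow> x \<in> \<Omega> \<and> y \<in> \<Omega>"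
  by (auto simp: disc_joins_def tanh_real_lt_1 intro!: holo_discs_in)

lemma holo_discs_mono: "D \<subseteq> \<Omega> \<Longrightarrow> holo_discs D \<subseteq> holo_discs \<Omega>"
  by (auto simp: holo_discs_def)

lemma continuous_on_holo_disc:
  fixes \<phi> :: "complex \<Rightarrow> complex ^ 'n"
  assumes "\<phi> \<in> holo_discs \<Omega>"
  shows "continuous_on (ball 0 1) \<phi>"
proof -
  have "continuous_on (ball 0 1) (\<lambda>\<zeta>. \<chi> i. \<phi> \<zeta> $ i)"
    using assms by (intro continuous_on_vec_lambda holomorphic_on_imp_continuous_on)
      (auto simp: holo_discs_def)
  then show ?thesis by simp
qed

lemma tanh_artanh_real: "\<bar>x\<bar> < 1 \<Longrightarrow> tanh (artanh x) = (x::real)"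
proof -
  assume "\<bar>x\<bar> < 1"
  then have x: "-1 < x" "x < 1" by auto
  then have pos: "(1 + x) / (1 - x) > 0" by simp
  have *: "exp (- 2 * artanh x) = (1 - x) / (1 + x)"
  proof -
    have "exp (- 2 * artanh x) = exp (- ln ((1 + x) / (1 - x)))" by (simp add: artanh_def)
    also have "\<dots> = (1 - x) / (1 + x)" using pos by (simp only: exp_minus exp_ln) (simp add: field_simps)
    finally show ?thesis .
  qed
  show ?thesis
    unfolding tanh_real_altdef * using x by (simp add: field_simps)
qed

lemma artanh_real_mono: "\<lbrakk>-1 < x; x \<le> y; y < 1\<rbrakk> \<Longrightarrow> artanh x \<le> artanh (y::real)"
  using tanh_real_le_iff[of "artanh x" "artanh y"] by (simp add: tanh_artanh_real)

lemma tanh_real_le: "0 \<le> x \<Longrightarrow> tanh x \<le> (x::real)"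
proof -
  assume "0 \<le> x"
  \<comment> \<open>The derivative of \<open>x - tanh x\<close> is the square of
    \<open>tanh x\<close>.\<close>
  have "(\<lambda>x. x - tanh x) 0 \<le> (\<lambda>x. x - tanh x) x"
    by (rule DERIV_nonneg_imp_nondecreasing[OF \<open>0 \<le> x\<close>])
      (auto intro!: derivative_eq_intros exI simp: less_imp_neq[OF cosh_real_pos, symmetric])
  then show ?thesis by simp
qed

text \<open>Rotating the disc moves \<open>\<alpha>\<close> to the positive real axis, so
  restricting to real parameters loses nothing. For \<open>\<alpha> = 0\<close> the factor
  \<open>sgn \<alpha>\<close> is 0 and the rotated disc is constant.\<close>

lemma disc_joins_artanh:
  assumes \<phi>: "\<phi> \<in> holo_discs \<Omega>" and \<alpha>: "cmod \<alpha> < 1"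
  shows "disc_joins \<Omega> (artanh (cmod \<alpha>)) (\<phi> 0) (\<phi> \<alpha>)"
proof -
  have le: "cmod (\<zeta> * sgn \<alpha>) < 1" if "cmod \<zeta> < 1" for \<zeta>
    using that by (simp add: norm_mult norm_sgn)
  have "(\<lambda>\<zeta>. \<phi> (\<zeta> * sgn \<alpha>)) \<in> holo_discs \<Omega>"
    by (rule holo_discs_compose[OF \<phi>]) (use le in \<open>auto intro!: holomorphic_intros\<close>)
  moreover have "of_real (cmod \<alpha>) * sgn \<alpha> = \<alpha>"
    by (simp add: sgn_eq)
  moreover have "artanh (cmod \<alpha>) \<ge> 0"
    using artanh_real_mono[of 0 "cmod \<alpha>"] \<alpha> by simp
  ultimately show ?thesis
    using \<alpha> unfolding disc_joins_def
    by (intro conjI bexI[of _ "\<lambda>\<zeta>. \<phi> (\<zeta> * sgn \<alpha>)"]) (auto simp: tanh_artanh_real)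
qed

lemma lempert_le:
  assumes "disc_joins \<Omega> s x y"
  shows "lempert \<Omega> x y \<le> s"
proof -
  define S where "S = {cmod \<alpha> |\<alpha>. \<alpha> \<in> ball 0 1 \<and> (\<exists>\<phi>\<in>holo_discs \<Omega>. \<phi> 0 = x \<and> \<phi> \<alpha> = y)}"
  have s: "0 \<le> s" "tanh s < 1" using assms by (auto simp: disc_joins_def tanh_real_lt_1)
  have "cmod (of_real (tanh s)) \<in> S"
    using assms s unfolding S_def disc_joins_def
    by (intro CollectI exI[of _ "of_real (tanh s)"]) auto
  then have mem: "tanh s \<in> S" using s by simp
  have "bdd_below S" by (rule bdd_belowI[of _ 0]) (auto simp: S_def)
  with mem have "Inf S \<le> tanh s" by (rule cInf_lower)
  moreover have "Inf S \<ge> 0" by (rule cInf_greatest) (use mem in \<open>auto simp: S_def\<close>)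
  ultimately have "artanh (Inf S) \<le> artanh (tanh s)"
    using s by (intro artanh_real_mono) auto
  then show ?thesis by (simp add: lempert_def lempert_tilde_def S_def artanh_tanh_real)
qed

text \<open>Together with \<open>lempert_le\<close> this identifies the Lempert function as the
  infimum of the lengths of joining discs. The assumed join keeps the infimum from running over the
  empty set.\<close>

lemma le_lempert:
  assumes "disc_joins \<Omega> s x y"
    and d: "\<And>s. disc_joins \<Omega> s x y \<Longrightarrow> d \<le> s"
  shows "d \<le> lempert \<Omega> x y"
proof -
  define S where "S = {cmod \<alpha> |\<alpha>. \<alpha> \<in> ball 0 1 \<and> (\<exists>\<phi>\<in>holo_discs \<Omega>. \<phi> 0 = x \<and> \<phi> \<alpha> = y)}"
  have s: "0 \<le> s" "tanh s < 1" using assms by (auto simp: disc_joins_def tanh_real_lt_1)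
  have "cmod (of_real (tanh s)) \<in> S"
    using assms s unfolding S_def disc_joins_def
    by (intro CollectI exI[of _ "of_real (tanh s)"]) auto
  then have mem: "tanh s \<in> S" using s by simp
  have "bdd_below S" by (rule bdd_belowI[of _ 0]) (auto simp: S_def)
  with mem have 1: "Inf S \<le> tanh s" by (rule cInf_lower)
  have "tanh d \<le> Inf S"
  proof (rule cInf_greatest)
    show "S \<noteq> {}" using mem by blast
    fix r assume "r \<in> S"
    then obtain \<alpha> \<phi> where *: "r = cmod \<alpha>" "cmod \<alpha> < 1" "\<phi> \<in> holo_discs \<Omega>" "\<phi> 0 = x" "\<phi> \<alpha> = y"
      by (auto simp: S_def)
    then have "d \<le> artanh r" using d disc_joins_artanh by blast
    then have "tanh d \<le> tanh (artanh r)" by simp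
    then show "tanh d \<le> r" using * by (simp add: tanh_artanh_real)
  qed
  \<comment> \<open>Monotonicity of \<open>artanh\<close> needs \<open>Inf S < 1\<close>, which the
    given disc provides.\<close>
  then have "artanh (tanh d) \<le> artanh (Inf S)"
    using 1 s by (intro artanh_real_mono) (auto simp: tanh_real_gt_neg1)
  then show ?thesis by (simp add: lempert_def lempert_tilde_def S_def artanh_tanh_real)
qed

section \<open>Any two points of a domain lie on a common disc\<close>

text \<open>The same coefficients define a polynomial in a complex variable.\<close>

lemma real_polynomial_function_extends_holomorphic:
  fixes f :: "real \<Rightarrow> real"
  assumes "real_polynomial_function f"
  obtains F where "F holomorphic_on UNIV" "\<And>t. F (complex_of_real t) = of_real (f t)"
proof -
  obtain a and n :: nat where f: "f = (\<lambda>x. \<Sum>i\<le>n. a i * x ^ i)"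
    using real_polynomial_function_imp_sum[OF assms] by blast
  show ?thesis
    by (rule that[of "\<lambda>z. \<Sum>i\<le>n. of_real (a i) * z ^ i"]) (auto simp: f intro!: holomorphic_intros)
qed

lemma complex_polynomial_function_extends_holomorphic:
  fixes g :: "real \<Rightarrow> complex"
  assumes "polynomial_function g"
  obtains F where "F holomorphic_on UNIV" "\<And>t. F (complex_of_real t) = g t"
proof -
  have "real_polynomial_function (Re \<circ> g)" "real_polynomial_function (Im \<circ> g)"
    using assms bounded_linear_Re bounded_linear_Im unfolding polynomial_function_def by blast+
  then obtain F G where FG: "F holomorphic_on UNIV" "\<And>t. F (complex_of_real t) = of_real (Re (g t))"
    "G holomorphic_on UNIV" "\<And>t. G (complex_of_real t) = of_real (Im (g t))"
    by (metis real_polynomial_function_extends_holomorphic comp_apply)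
  \<comment> \<open>The extensions \<open>F\<close> and \<open>G\<close> are real only on the real
    axis in general, and only there is the value compared with \<open>g\<close>.\<close>
  show ?thesis
    by (rule that[of "\<lambda>z. F z + \<i> * G z"])
      (use FG in \<open>auto intro!: holomorphic_intros simp: complex_eq_iff\<close>)
qed

text \<open>A polynomial path in the domain extends to a holomorphic map on a convex neighbourhood of
  the segment \<open>[0,1]\<close>, which the Riemann mapping theorem identifies with the disc.\<close>

lemma disc_joins_exists:
  fixes \<Omega> :: "(complex ^ 'n) set"
  assumes dom: "is_domain \<Omega>" and xy: "x \<in> \<Omega>" "y \<in> \<Omega>"
  obtains s where "disc_joins \<Omega> s x y"
proof -
  obtain g where g: "polynomial_function g" "path_image g \<subseteq> \<Omega>" "pathstart g = x" "pathfinish g = y"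
    using connected_open_polynomial_connected dom xy unfolding is_domain_def by metis
  have "\<exists>F. F holomorphic_on UNIV \<and> (\<forall>t. F (complex_of_real t) = g t $ i)" for i
  proof -
    have "polynomial_function ((\<lambda>v. v $ i) \<circ> g)"
      using polynomial_function_compose[OF g(1)
          polynomial_function_bounded_linear[OF bounded_linear_vec_nth[of i]]] .
    then show ?thesis
      by (rule complex_polynomial_function_extends_holomorphic) (auto simp: o_def)
  qed
  then obtain F where F: "\<And>i. F i holomorphic_on UNIV" "\<And>i t. F i (complex_of_real t) = g t $ i"
    by metis
  define P where "P = (\<lambda>\<zeta>. \<chi> i. F i \<zeta>)"
  have P_real: "P (complex_of_real t) = g t" for t
    by (simp add: P_def F vec_eq_iff)
  have "continuous_on UNIV P"
    unfolding P_def by (intro continuous_on_vec_lambda holomorphic_on_imp_continuous_on F)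
  then have "open (P -` \<Omega>)"
    using dom by (simp add: is_domain_def open_vimage)
  moreover have "closed_segment 0 1 \<subseteq> P -` \<Omega>"
  proof
    fix \<zeta> :: complex assume "\<zeta> \<in> closed_segment 0 1"
    then obtain t where "0 \<le> t" "t \<le> 1" "\<zeta> = of_real t"
      by (auto simp: closed_segment_def scaleR_conv_of_real)
    then show "\<zeta> \<in> P -` \<Omega>"
      using g(2) by (auto simp: P_real path_image_def)
  qed
  ultimately obtain e where e: "e > 0" "(\<Union>\<zeta>\<in>closed_segment 0 1. ball \<zeta> e) \<subseteq> P -` \<Omega>"
    using compact_subset_open_imp_ball_epsilon_subset compact_segment by metis
  \<comment> \<open>As the Minkowski sum of a segment and a disc, \<open>N\<close> is convex and
    bounded, hence simply connected and not the whole plane.\<close>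
  define N where "N = (\<Union>a\<in>closed_segment 0 (1::complex). ball a e)"
  have N_sum: "N = (\<Union>a\<in>closed_segment 0 1. \<Union>b\<in>ball 0 e. {a + b})"
  proof -
    have "ball a e = (\<Union>b\<in>ball 0 e. {a + b})" for a :: complex
      using ball_translation[of a 0 e] by (simp add: UNION_singleton_eq_range)
    then show ?thesis unfolding N_def by (rule SUP_cong[OF HOL.refl])
  qed
  have "simply_connected N"
    unfolding N_sum by (intro convex_imp_simply_connected convex_sums) auto
  moreover have "N \<noteq> UNIV"
  proof -
    have "bounded N" unfolding N_sum by (intro bounded_sums) (auto simp: bounded_closed_segment)
    then show ?thesis by auto
  qed
  moreover have "open N" unfolding N_def by auto
  moreover have N01: "0 \<in> N" "1 \<in> N" using e(1) by (force simp: N_def)+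
  ultimately obtain f G where fG: "G holomorphic_on ball 0 1"
      "\<forall>z\<in>N. f z \<in> ball 0 1 \<and> G (f z) = z" "\<forall>z\<in>ball 0 1. G z \<in> N \<and> f (G z) = z"
    using Riemann_mapping_theorem[of N] by blast
  define a where "a = f 0"
  have a: "cmod a < 1" and b: "cmod (f 1) < 1" using fG(2) N01 by (auto simp: a_def)
  define \<psi> where "\<psi> = (\<lambda>\<zeta>. P (G \<zeta>))"
  have \<psi>: "\<psi> \<in> holo_discs \<Omega>"
  proof -
    have "(\<lambda>\<zeta>. F i (G \<zeta>)) holomorphic_on ball 0 1" for i
      using holomorphic_on_compose_gen[OF fG(1) F(1)[of i]] by (simp add: o_def)
    moreover have "P (G \<zeta>) \<in> \<Omega>" if "\<zeta> \<in> ball 0 1" for \<zeta>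
      using that fG(3) e(2) unfolding N_def[symmetric] by blast
    ultimately show ?thesis by (auto simp: holo_discs_def \<psi>_def) (simp add: P_def)
  qed
  \<comment> \<open>\<open>Moebius_function 0 (-a)\<close> sends 0 to \<open>a = f 0\<close> and is
    inverse to \<open>Moebius_function 0 a\<close>; it recentres the disc so that the origin goes to
    \<open>x\<close>.\<close>
  define \<phi> where "\<phi> = (\<lambda>\<zeta>. \<psi> (Moebius_function 0 (-a) \<zeta>))"
  have \<phi>: "\<phi> \<in> holo_discs \<Omega>"
    unfolding \<phi>_def using a
    by (intro holo_discs_compose[OF \<psi>] Moebius_function_holomorphic) (auto simp: Moebius_function_norm_lt_1)
  have "\<phi> 0 = x"
    using fG(2) N01 P_real[of 0] g(3)
    by (simp add: \<phi>_def \<psi>_def Moebius_function_of_zero a_def pathstart_def)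
  moreover have "\<phi> (Moebius_function 0 a (f 1)) = y"
    using fG(2) N01 P_real[of 1] g(4) a b
    by (simp add: \<phi>_def \<psi>_def Moebius_function_compose pathfinish_def)
  moreover have "cmod (Moebius_function 0 a (f 1)) < 1"
    using a b by (rule Moebius_function_norm_lt_1)
  ultimately show ?thesis
    using disc_joins_artanh[OF \<phi>] that by metis
qed

lemma lempert_nonneg:
  assumes "is_domain \<Omega>" "x \<in> \<Omega>" "y \<in> \<Omega>"
  shows "0 \<le> lempert \<Omega> x y"
  using disc_joins_exists[OF assms] le_lempert[of \<Omega> _ x y 0] by (metis disc_joins_def)

section \<open>The Kobayashi distance: existence, monotonicity, positivity\<close>

text \<open>The pointwise supremum of all pseudodistances below \<open>l\<close> works: the axioms
  pass to suprema, \<open>l\<close> is an upper bound, and the zero pseudodistance makes the family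
  non-empty.\<close>

lemma largest_pseudodistance_exists:
  assumes l: "\<And>x y. x \<in> S \<Longrightarrow> y \<in> S \<Longrightarrow> 0 \<le> l x y"
  shows "\<exists>k. largest_pseudodistance_below S l k"
proof -
  define \<D> where "\<D> = {d. pseudodistance_on S d \<and> (\<forall>x\<in>S. \<forall>y\<in>S. d x y \<le> l x y)}"
  define k where "k = (\<lambda>x y. SUP d\<in>\<D>. d x y)"
  have ne: "(\<lambda>x y. 0) \<in> \<D>" using l by (auto simp: \<D>_def pseudodistance_on_def)
  have bdd: "bdd_above ((\<lambda>d. d x y) ` \<D>)" if "x \<in> S" "y \<in> S" for x y
    by (rule bdd_aboveI[of _ "l x y"]) (use that in \<open>auto simp: \<D>_def\<close>)
  have up: "d x y \<le> k x y" if "d \<in> \<D>" "x \<in> S" "y \<in> S" for d x y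
    unfolding k_def by (rule cSUP_upper[OF that(1) bdd[OF that(2,3)]])
  have least: "k x y \<le> c" if "\<And>d. d \<in> \<D> \<Longrightarrow> d x y \<le> c" for x y c
    unfolding k_def by (rule cSUP_least) (use ne that in auto)
  have "k x x = 0" if "x \<in> S" for x
    by (intro antisym least) (use that up[OF ne] in \<open>auto simp: \<D>_def pseudodistance_on_def\<close>)
  moreover have "0 \<le> k x y" if "x \<in> S" "y \<in> S" for x y
    using up[OF ne] that by auto
  moreover have "k x y = k y x" if "x \<in> S" "y \<in> S" for x y
  proof -
    have "d x y = d y x" if "d \<in> \<D>" for d
      using that \<open>x \<in> S\<close> \<open>y \<in> S\<close> by (simp add: \<D>_def pseudodistance_on_def)
    then show ?thesis unfolding k_def by (auto intro: SUP_cong)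
  qed
  moreover have "k x z \<le> k x y + k y z" if "x \<in> S" "y \<in> S" "z \<in> S" for x y z
  proof (rule least)
    fix d assume d: "d \<in> \<D>"
    then have "d x z \<le> d x y + d y z" using that by (simp add: \<D>_def pseudodistance_on_def)
    then show "d x z \<le> k x y + k y z" using up[OF d] that by (smt (verit))
  qed
  moreover have "k x y \<le> l x y" if "x \<in> S" "y \<in> S" for x y
    by (rule least) (use that in \<open>auto simp: \<D>_def\<close>)
  ultimately have "largest_pseudodistance_below S l k"
    using up unfolding largest_pseudodistance_below_def pseudodistance_on_def[of S k]
    by (auto simp: \<D>_def)
  then show ?thesis by (intro exI)
qed

lemma kobayashi_largest:
  assumes "is_domain \<Omega>"
  shows "largest_pseudodistance_below \<Omega> (lempert \<Omega>) (kobayashi \<Omega>)"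
  unfolding kobayashi_def
  by (rule someI_ex[OF largest_pseudodistance_exists]) (rule lempert_nonneg[OF assms])

lemma kobayashi_self: "is_domain \<Omega> \<Longrightarrow> x \<in> \<Omega> \<Longrightarrow> kobayashi \<Omega> x x = 0"
  and kobayashi_commute: "is_domain \<Omega> \<Longrightarrow> x \<in> \<Omega> \<Longrightarrow> y \<in> \<Omega> \<Longrightarrow> kobayashi \<Omega> x y = kobayashi \<Omega> y x"
  and kobayashi_triangle: "is_domain \<Omega> \<Longrightarrow> x \<in> \<Omega> \<Longrightarrow> y \<in> \<Omega> \<Longrightarrow> z \<in> \<Omega> \<Longrightarrow>
         kobayashi \<Omega> x z \<le> kobayashi \<Omega> x y + kobayashi \<Omega> y z"
  using kobayashi_largest[of \<Omega>]
  unfolding largest_pseudodistance_below_def pseudodistance_on_def by blast+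

lemma kobayashi_le:
  assumes "is_domain \<Omega>" "disc_joins \<Omega> s x y"
  shows "kobayashi \<Omega> x y \<le> s"
proof -
  have "kobayashi \<Omega> x y \<le> lempert \<Omega> x y"
    using kobayashi_largest[OF assms(1)] disc_joins_in[OF assms(2)]
    unfolding largest_pseudodistance_below_def by blast
  then show ?thesis using lempert_le[OF assms(2)] by simp
qed

text \<open>All lower bounds for the Kobayashi distance come from this form of maximality. The
  competitors used below are the distance of a larger domain, a scaled coordinate difference, and
  the infimum over chains.\<close>

lemma pseudodistance_le_kobayashi:
  assumes "is_domain \<Omega>" "pseudodistance_on \<Omega> d"
    and d: "\<And>x y s. disc_joins \<Omega> s x y \<Longrightarrow> d x y \<le> s"
    and "x \<in> \<Omega>" "y \<in> \<Omega>"
  shows "d x y \<le> kobayashi \<Omega> x y"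
proof -
  have "d x y \<le> lempert \<Omega> x y" if "x \<in> \<Omega>" "y \<in> \<Omega>" for x y
    using disc_joins_exists[OF assms(1) that] le_lempert d by metis
  then show ?thesis
    using kobayashi_largest[OF assms(1)] assms(2,4,5) unfolding largest_pseudodistance_below_def
    by blast
qed

text \<open>A disc in \<open>D\<close> is also a disc in \<open>\<Omega>\<close>, so the distance of
  \<open>\<Omega>\<close> competes on \<open>D\<close>.\<close>

lemma kobayashi_antimono:
  assumes "is_domain D" "is_domain \<Omega>" "D \<subseteq> \<Omega>" "x \<in> D" "y \<in> D"
  shows "kobayashi \<Omega> x y \<le> kobayashi D x y"
proof (rule pseudodistance_le_kobayashi[OF assms(1) _ _ assms(4,5)])
  have "pseudodistance_on \<Omega> (kobayashi \<Omega>)"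
    using kobayashi_largest[OF assms(2)] by (simp add: largest_pseudodistance_below_def)
  then show "pseudodistance_on D (kobayashi \<Omega>)"
    using assms(3) unfolding pseudodistance_on_def by blast
  show "kobayashi \<Omega> x y \<le> s" if "disc_joins D s x y" for x y s
    using that holo_discs_mono[OF assms(3)] kobayashi_le[OF assms(2)]
    unfolding disc_joins_def by blast
qed

lemma kobayashi_pos:
  fixes D :: "(complex ^ 'n) set"
  assumes "is_domain D" "bounded D" "x \<in> D" "y \<in> D" "x \<noteq> y"
  shows "0 < kobayashi D x y"
proof -
  obtain i where i: "x $ i \<noteq> y $ i" using assms(5) by (auto simp: vec_eq_iff)
  obtain B where B: "\<And>z. z \<in> D \<Longrightarrow> norm z < B" "0 < B"
    using bounded_pos_less assms(2) by blast
  \<comment> \<open>Coordinates of points of \<open>D\<close> have modulus below \<open>B\<close>,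
    so dividing their differences by \<open>2 * B\<close> gives values in the unit disc, as the
    Schwarz lemma requires.\<close>
  define d where "d = (\<lambda>u v :: complex ^ 'n. cmod (u $ i - v $ i) / (2 * B))"
  have "d x y \<le> kobayashi D x y"
  proof (rule pseudodistance_le_kobayashi[OF assms(1) _ _ assms(3,4)])
    have "cmod (a - c) / (2 * B) \<le> cmod (a - b) / (2 * B) + cmod (b - c) / (2 * B)" for a b c
      using norm_triangle_ineq[of "a - b" "b - c"] B(2)
      by (simp add: divide_simps)
    then show "pseudodistance_on D d"
      using B(2) unfolding pseudodistance_on_def d_def by (auto simp: norm_minus_commute[of "y $ i" "x $ i" for x y])
    fix u v s assume "disc_joins D s u v"
    then obtain \<phi> where \<phi>: "\<phi> \<in> holo_discs D" "\<phi> 0 = u" "\<phi> (of_real (tanh s)) = v" and s: "0 \<le> s"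
      by (auto simp: disc_joins_def)
    define f where "f = (\<lambda>\<zeta>. (\<phi> \<zeta> $ i - u $ i) / of_real (2 * B))"
    have bd: "cmod (z $ i) < B" if "z \<in> D" for z
      using Finite_Cartesian_Product.norm_nth_le[of z i] B(1)[OF that] by simp
    have "cmod (f (of_real (tanh s))) \<le> cmod (of_real (tanh s))"
    proof (rule Schwarz_Lemma)
      show "f holomorphic_on ball 0 1"
        using \<phi>(1) B(2) unfolding f_def holo_discs_def by (auto intro!: holomorphic_intros)
      show "f 0 = 0" by (simp add: f_def \<phi>)
      show "cmod (f z) < 1" if "cmod z < 1" for z
      proof -
        have "cmod (\<phi> z $ i - u $ i) < B + B"
          using bd[OF holo_discs_in[OF \<phi>(1) that]] bd[OF holo_discs_in[OF \<phi>(1), of 0]] \<phi>(2)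
          by (intro order.strict_trans1[OF norm_triangle_ineq4] add_strict_mono) auto
        then show ?thesis using B(2) by (simp add: f_def norm_divide norm_mult)
      qed
      show "cmod (of_real (tanh s)) < 1" using s by (simp add: tanh_real_lt_1)
    qed
    then have "d u v \<le> tanh s"
      using s B(2) by (simp add: f_def d_def \<phi> norm_divide norm_mult norm_minus_commute)
    also have "\<dots> \<le> s" using s by (rule tanh_real_le)
    finally show "d u v \<le> s" .
  qed
  moreover have "d x y > 0" using i B(2) by (simp add: d_def)
  ultimately show ?thesis by simp
qed

section \<open>Chains of short discs\<close>

text \<open>Each link has length at most \<open>\<delta>\<close>; the last argument accumulates the
  total length.\<close>

inductive disc_chain :: "(complex ^ 'n) set \<Rightarrow> real \<Rightarrow> complex ^ 'n \<Rightarrow> complex ^ 'n \<Rightarrow> real \<Rightarrow> bool"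
  for \<Omega> \<delta> where
  refl: "x \<in> \<Omega> \<Longrightarrow> disc_chain \<Omega> \<delta> x x 0"
| step: "disc_joins \<Omega> s x y \<Longrightarrow> s \<le> \<delta> \<Longrightarrow> disc_chain \<Omega> \<delta> y z t \<Longrightarrow> disc_chain \<Omega> \<delta> x z (s + t)"

text \<open>On the real diameter this Moebius map is hyperbolic translation by \<open>a\<close>: the
  formula is the addition theorem for \<open>tanh\<close>.\<close>

lemma Moebius_function_tanh:
  "Moebius_function 0 (- of_real (tanh a)) (of_real (tanh h)) = of_real (tanh (a + h))"
  using tanh_add[of a h] cosh_real_pos[of a] cosh_real_pos[of h]
  by (simp add: Moebius_function_simple add_ac)

lemma disc_joins_along_disc:
  assumes "\<phi> \<in> holo_discs \<Omega>" "0 \<le> h"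
  shows "disc_joins \<Omega> h (\<phi> (of_real (tanh a))) (\<phi> (of_real (tanh (a + h))))"
proof -
  have 1: "cmod (- of_real (tanh a)) < 1" using tanh_real_bounds[of a] by (simp add: abs_less_iff)
  have "(\<lambda>\<zeta>. \<phi> (Moebius_function 0 (- of_real (tanh a)) \<zeta>)) \<in> holo_discs \<Omega>"
    using 1 by (intro holo_discs_compose[OF assms(1)] Moebius_function_holomorphic)
      (auto intro!: Moebius_function_norm_lt_1 simp del: norm_minus_cancel norm_of_real)
  then show ?thesis
    unfolding disc_joins_def using assms(2)
    by (intro conjI bexI[of _ "\<lambda>\<zeta>. \<phi> (Moebius_function 0 (- of_real (tanh a)) \<zeta>)"])
      (auto simp: Moebius_function_tanh Moebius_function_of_zero)
qed

text \<open>The disc \<open>\<phi> (- \<zeta>)\<close> takes the value \<open>y\<close> at parameter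
  \<open>- s\<close> and \<open>x\<close> at 0; moving forward by \<open>s\<close> leads from
  \<open>y\<close> to \<open>x\<close>.\<close>

lemma disc_joins_commute:
  assumes "disc_joins \<Omega> s x y"
  shows "disc_joins \<Omega> s y x"
proof -
  obtain \<phi> where \<phi>: "\<phi> \<in> holo_discs \<Omega>" "\<phi> 0 = x" "\<phi> (of_real (tanh s)) = y" and s: "0 \<le> s"
    using assms by (auto simp: disc_joins_def)
  have "(\<lambda>\<zeta>. \<phi> (- \<zeta>)) \<in> holo_discs \<Omega>"
    by (rule holo_discs_compose[OF \<phi>(1)]) (auto intro!: holomorphic_intros)
  from disc_joins_along_disc[OF this s, of "- s"] show ?thesis using \<phi> by simp
qed

lemma disc_chain_props: "disc_chain \<Omega> \<delta> x y t \<Longrightarrow> x \<in> \<Omega> \<and> y \<in> \<Omega> \<and> 0 \<le> t"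
  by (induction rule: disc_chain.induct) (auto simp: disc_joins_in, auto simp: disc_joins_def)

lemma kobayashi_le_disc_chain:
  assumes "is_domain \<Omega>" "disc_chain \<Omega> \<delta> x y t"
  shows "kobayashi \<Omega> x y \<le> t"
  using assms(2)
proof (induction rule: disc_chain.induct)
  case (refl x)
  then show ?case using kobayashi_self assms(1) by fastforce
next
  case (step s x y z t)
  then show ?case
    using kobayashi_triangle[OF assms(1), of x y z] kobayashi_le[OF assms(1) step(1)]
      disc_joins_in[OF step(1)] disc_chain_props[OF step(3)] by simp
qed

lemma disc_chain_trans:
  "disc_chain \<Omega> \<delta> x y s \<Longrightarrow> disc_chain \<Omega> \<delta> y z t \<Longrightarrow> disc_chain \<Omega> \<delta> x z (s + t)"
proof (induction rule: disc_chain.induct)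
  case (step s x y y' t')
  then show ?case using disc_chain.step[OF step(1,2), of z "t' + t"] by (simp add: add.assoc)
qed simp

lemma disc_chain_commute: "disc_chain \<Omega> \<delta> x y t \<Longrightarrow> disc_chain \<Omega> \<delta> y x t"
proof (induction rule: disc_chain.induct)
  case (step s x y z t)
  have "disc_chain \<Omega> \<delta> y x (s + 0)"
    using disc_chain.step[OF disc_joins_commute[OF step(1)] step(2) disc_chain.refl]
      disc_joins_in[OF step(1)] by blast
  from disc_chain_trans[OF step.IH this] show ?case by (simp add: add.commute)
qed (rule disc_chain.refl)

lemma disc_chain_along_disc:
  assumes "\<phi> \<in> holo_discs \<Omega>" "0 \<le> h" "h \<le> \<delta>"
  shows "disc_chain \<Omega> \<delta> (\<phi> (of_real (tanh a))) (\<phi> (of_real (tanh (a + real n * h)))) (real n * h)"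
proof (induction n arbitrary: a)
  case 0
  have "\<phi> (of_real (tanh a)) \<in> \<Omega>"
    using tanh_real_bounds[of a] by (intro holo_discs_in[OF assms(1)]) (simp add: abs_less_iff)
  then show ?case by (simp add: disc_chain.refl)
next
  case (Suc n)
  have "real (Suc n) * h = h + real n * h" by (simp add: algebra_simps)
  then show ?case
    using disc_chain.step[OF disc_joins_along_disc[OF assms(1,2)] assms(3) Suc.IH[of "a + h"]]
    by (simp add: add.assoc)
qed

text \<open>Equally spaced points of one geodesic cut the disc into short links without increasing
  the total length.\<close>

lemma disc_chain_of_disc_joins:
  assumes "disc_joins \<Omega> s x y" "0 < \<delta>"
  shows "disc_chain \<Omega> \<delta> x y s"
proof -
  obtain \<phi> where \<phi>: "\<phi> \<in> holo_discs \<Omega>" "\<phi> 0 = x" "\<phi> (of_real (tanh s)) = y" and s: "0 \<le> s"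
    using assms by (auto simp: disc_joins_def)
  \<comment> \<open>The strict inequality forces \<open>n > 0\<close> even when
    \<open>s = 0\<close>.\<close>
  obtain n where n: "s / \<delta> < real n" using reals_Archimedean2 by blast
  then have "n > 0" using s assms(2) by (auto intro: gr0I simp: divide_less_0_iff)
  then have "s / real n \<le> \<delta>" "real n * (s / real n) = s"
    using n assms(2) by (auto simp: field_simps)
  then show ?thesis
    using disc_chain_along_disc[OF \<phi>(1), of "s / real n" \<delta> 0 n] s \<phi> by simp
qed

text \<open>For fixed \<open>\<delta>\<close> the infimum of chain lengths is a pseudodistance, and
  by subdivision it does not exceed the length of any joining disc. Maximality then places it below
  the Kobayashi distance.\<close>

lemma disc_chain_exists:
  fixes \<Omega> :: "(complex ^ 'n) set"
  assumes dom: "is_domain \<Omega>" and "0 < \<delta>" "0 < \<epsilon>" and xy: "x \<in> \<Omega>" "y \<in> \<Omega>"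
  obtains t where "disc_chain \<Omega> \<delta> x y t" "t < kobayashi \<Omega> x y + \<epsilon>"
proof -
  define d where "d = (\<lambda>x y. Inf {t. disc_chain \<Omega> \<delta> x y t})"
  have ne: "\<exists>t. disc_chain \<Omega> \<delta> x y t" if "x \<in> \<Omega>" "y \<in> \<Omega>" for x y
    using disc_joins_exists[OF dom that] disc_chain_of_disc_joins assms(2) by metis
  have low: "d x y \<le> t" if "disc_chain \<Omega> \<delta> x y t" for x y t
    unfolding d_def
    by (rule cInf_lower) (use that in \<open>auto intro!: bdd_belowI[of _ 0] simp: disc_chain_props\<close>)
  have great: "c \<le> d x y" if "x \<in> \<Omega>" "y \<in> \<Omega>" "\<And>t. disc_chain \<Omega> \<delta> x y t \<Longrightarrow> c \<le> t" for x y c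
    unfolding d_def by (rule cInf_greatest) (use that ne in auto)
  have nonneg: "0 \<le> d x y" if "x \<in> \<Omega>" "y \<in> \<Omega>" for x y
    using that by (rule great) (simp add: disc_chain_props)
  have "d x y \<le> kobayashi \<Omega> x y"
  proof (rule pseudodistance_le_kobayashi[OF dom _ _ xy])
    have "d x x = 0" if "x \<in> \<Omega>" for x
      using low[OF disc_chain.refl[OF that]] nonneg[OF that that] by simp
    moreover have "d x y = d y x" for x y
      unfolding d_def using disc_chain_commute by (intro arg_cong[of _ _ Inf]) blast
    moreover have "d x z \<le> d x y + d y z" if "x \<in> \<Omega>" "y \<in> \<Omega>" "z \<in> \<Omega>" for x y z
    proof -
      \<comment> \<open>Moving one term to the left lets the two infima be treated one after the
        other.\<close>
      have "d x z - d x y \<le> d y z"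
      proof (rule great[OF that(2,3)])
        fix t assume t: "disc_chain \<Omega> \<delta> y z t"
        have "d x z - t \<le> d x y"
        proof (rule great[OF that(1,2)])
          fix s assume "disc_chain \<Omega> \<delta> x y s"
          from low[OF disc_chain_trans[OF this t]] show "d x z - t \<le> s" by simp
        qed
        then show "d x z - d x y \<le> t" by simp
      qed
      then show ?thesis by simp
    qed
    ultimately show "pseudodistance_on \<Omega> d"
      using nonneg unfolding pseudodistance_on_def by blast
    show "d x y \<le> s" if "disc_joins \<Omega> s x y" for x y s
      using low disc_chain_of_disc_joins[OF that assms(2)] by blast
  qed
  with assms(3) have "Inf {t. disc_chain \<Omega> \<delta> x y t} < kobayashi \<Omega> x y + \<epsilon>"
    by (simp add: d_def)
  then have "\<exists>t\<in>{t. disc_chain \<Omega> \<delta> x y t}. t < kobayashi \<Omega> x y + \<epsilon>"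
    using ne[OF xy] by (intro cInf_lessD) auto
  then show ?thesis using that by blast
qed

section \<open>Localization of discs and chains\<close>

lemma is_domain_component:
  fixes S :: "'a::real_normed_vector set"
  assumes "open S" "x \<in> S"
  shows "is_domain (connected_component_set S x)"
  using assms unfolding is_domain_def
  by (auto simp: open_connected_component intro!: exI[of _ x])

text \<open>Royden's localization: a disc starting at Kobayashi distance at least \<open>R\<close> from \<open>\<Omega> - U\<close>,
  shrunk by the factor \<open>tanh R\<close>, stays in \<open>U\<close>.\<close>

lemma disc_joins_localize:
  fixes \<Omega> U :: "(complex ^ 'n) set"
  assumes dom: "is_domain \<Omega>" and "open U"
    and far: "\<And>b. b \<in> \<Omega> - U \<Longrightarrow> R \<le> kobayashi \<Omega> x b"
    and "0 < R" and joins: "disc_joins \<Omega> s x y"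
    and u: "0 \<le> u" "tanh s \<le> tanh R * tanh u"
  shows "connected_component (\<Omega> \<inter> U) x y" "kobayashi_comp (\<Omega> \<inter> U) x y \<le> u"
proof -
  define T where "T = tanh R"
  have T: "0 < T" "T < 1" using \<open>0 < R\<close> by (auto simp: T_def tanh_real_lt_1)
  obtain \<phi> where \<phi>: "\<phi> \<in> holo_discs \<Omega>" "\<phi> 0 = x" "\<phi> (of_real (tanh s)) = y" and s: "0 \<le> s"
    using joins by (auto simp: disc_joins_def)
  have shrink: "cmod (of_real T * \<zeta>) < T" if "cmod \<zeta> < 1" for \<zeta>
    using that T by (simp add: norm_mult)
  define \<psi> where "\<psi> = (\<lambda>\<zeta>. \<phi> (of_real T * \<zeta>))"
  have \<psi>: "\<psi> \<in> holo_discs \<Omega>"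
    unfolding \<psi>_def using order.strict_trans[OF shrink T(2)]
    by (intro holo_discs_compose[OF \<phi>(1)]) (auto intro!: holomorphic_intros)
  \<comment> \<open>A value outside \<open>U\<close> would be at distance at least \<open>R\<close>
    from \<open>x\<close>, while \<open>\<phi>\<close> joins it to \<open>x\<close> with length
    \<open>artanh (T * cmod \<zeta>) < R\<close>.\<close>
  have \<psi>_U: "\<psi> \<zeta> \<in> \<Omega> \<inter> U" if \<zeta>: "cmod \<zeta> < 1" for \<zeta>
  proof (rule ccontr)
    assume "\<psi> \<zeta> \<notin> \<Omega> \<inter> U"
    then have "R \<le> kobayashi \<Omega> x (\<psi> \<zeta>)"
      using far holo_discs_in[OF \<psi> \<zeta>] by blast
    also have "\<dots> \<le> artanh (cmod (of_real T * \<zeta>))"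
      using kobayashi_le[OF dom disc_joins_artanh[OF \<phi>(1), of "of_real T * \<zeta>"]]
        shrink[OF \<zeta>] T \<phi>(2) by (simp add: \<psi>_def)
    finally have "T \<le> tanh (artanh (cmod (of_real T * \<zeta>)))"
      unfolding T_def by simp
    then show False using shrink[OF \<zeta>] T by (simp add: tanh_artanh_real)
  qed
  define D where "D = connected_component_set (\<Omega> \<inter> U) x"
  have x: "x = \<psi> 0" by (simp add: \<psi>_def \<phi>)
  \<comment> \<open>The image is connected and contains \<open>x\<close>, so the shrunken disc lies
    in the component of \<open>x\<close> and bounds the distance there.\<close>
  have "connected (\<psi> ` ball 0 1)"
    by (intro connected_continuous_image continuous_on_holo_disc[OF \<psi>]) auto
  then have sub: "\<psi> ` ball 0 1 \<subseteq> D"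
    unfolding D_def x using \<psi>_U by (intro connected_component_maximal) auto
  then have \<psi>_D: "\<psi> \<in> holo_discs D" using \<psi> by (auto simp: holo_discs_def)
  \<comment> \<open>The parameter at which the shrunken disc reaches \<open>y\<close>; the
    assumption on \<open>u\<close> says exactly that \<open>v \<le> tanh u\<close>.\<close>
  define v where "v = tanh s / T"
  have v: "0 \<le> v" "v \<le> tanh u" using s u T by (auto simp: v_def T_def field_simps)
  then have v1: "v < 1" using tanh_real_lt_1[of u] by simp
  have y: "y = \<psi> (of_real v)" using T \<phi>(3) by (simp add: \<psi>_def v_def)
  show "connected_component (\<Omega> \<inter> U) x y"
    using holo_discs_in[OF \<psi>_D, of "of_real v"] v v1 unfolding y D_def by simp
  have "x \<in> \<Omega> \<inter> U" using \<psi>_U[of 0] x by simp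
  moreover have "open (\<Omega> \<inter> U)" using dom assms(2) by (auto simp: is_domain_def)
  ultimately have "is_domain D" unfolding D_def by (intro is_domain_component)
  moreover have "disc_joins D (artanh (cmod (of_real v))) x y"
    unfolding x y using v v1 by (intro disc_joins_artanh[OF \<psi>_D]) auto
  ultimately have "kobayashi D x y \<le> artanh v" using kobayashi_le v by fastforce
  also have "\<dots> \<le> artanh (tanh u)"
    using v by (intro artanh_real_mono) (auto simp: tanh_real_lt_1)
  finally show "kobayashi_comp (\<Omega> \<inter> U) x y \<le> u"
    by (simp add: kobayashi_comp_def D_def artanh_tanh_real)
qed

text \<open>Averaging the triangle inequalities for \<open>k(z,b)\<close> and \<open>k(w,b)\<close> through a vertex \<open>x\<close> of the chain
  gives \<open>k(x,b) \<ge> (z|w)\<^sub>b - \<epsilon>/2\<close>.\<close>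

lemma disc_chain_localize:
  fixes \<Omega> U :: "(complex ^ 'n) set"
  assumes dom: "is_domain \<Omega>" and "open U" and zw: "z \<in> \<Omega>" "w \<in> \<Omega>"
    and far: "\<And>b. b \<in> \<Omega> - U \<Longrightarrow> R + \<epsilon> / 2 \<le> gromov_product \<Omega> b z w"
    and "0 < R" "0 \<le> C"
    and C: "\<And>s. 0 \<le> s \<Longrightarrow> s \<le> \<delta> \<Longrightarrow> tanh s \<le> tanh R * tanh (C * s)"
    and "disc_chain \<Omega> \<delta> x w t" and "kobayashi \<Omega> z x + t \<le> kobayashi \<Omega> z w + \<epsilon>"
  shows "connected_component (\<Omega> \<inter> U) x w \<and> kobayashi_comp (\<Omega> \<inter> U) x w \<le> C * t"
proof -
  have op: "open (\<Omega> \<inter> U)" using dom assms(2) by (auto simp: is_domain_def)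
  have near: "R \<le> kobayashi \<Omega> x b"
    if "disc_chain \<Omega> \<delta> x w t" "kobayashi \<Omega> z x + t \<le> kobayashi \<Omega> z w + \<epsilon>" "b \<in> \<Omega> - U" for x t b
  proof -
    have x: "x \<in> \<Omega>" and b: "b \<in> \<Omega>" using disc_chain_props[OF that(1)] that(3) by auto
    have "kobayashi \<Omega> x w \<le> t" by (rule kobayashi_le_disc_chain[OF dom that(1)])
    moreover have "kobayashi \<Omega> z b \<le> kobayashi \<Omega> z x + kobayashi \<Omega> x b"
      using kobayashi_triangle[OF dom zw(1) x b] .
    moreover have "kobayashi \<Omega> w b \<le> kobayashi \<Omega> x w + kobayashi \<Omega> x b"
      using kobayashi_triangle[OF dom zw(2) x b] kobayashi_commute[OF dom zw(2) x] by simp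
    ultimately show ?thesis
      using far[OF that(3)] that(2) unfolding gromov_product_def by argo
  qed
  \<comment> \<open>A vertex outside \<open>U\<close> could itself serve as \<open>b\<close>, at
    distance 0 from itself, against \<open>0 < R\<close>.\<close>
  have in_U: "x \<in> \<Omega> \<inter> U"
    if "disc_chain \<Omega> \<delta> x w t" "kobayashi \<Omega> z x + t \<le> kobayashi \<Omega> z w + \<epsilon>" for x t
  proof (rule ccontr)
    assume "x \<notin> \<Omega> \<inter> U"
    moreover have "x \<in> \<Omega>" using disc_chain_props[OF that(1)] by simp
    ultimately show False
      using near[OF that, of x] kobayashi_self[OF dom, of x] \<open>0 < R\<close> by simp
  qed
  \<comment> \<open>The induction peels links off the front: \<open>z\<close> and \<open>w\<close>
    stay fixed while \<open>x\<close> advances, and the bound on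
    \<open>kobayashi \<Omega> z x + t\<close> is the invariant.\<close>
  show ?thesis
    using assms(9,10)
  proof (induction x w' \<equiv> w t rule: disc_chain.induct)
    case refl
    have w: "w \<in> \<Omega> \<inter> U"
      by (rule in_U[OF disc_chain.refl[OF zw(2)]]) (use refl in auto)
    then have "kobayashi_comp (\<Omega> \<inter> U) w w = 0"
      unfolding kobayashi_comp_def by (intro kobayashi_self is_domain_component op) auto
    with w show ?case by simp
  next
    case (step s x y t)
    note props = disc_joins_in[OF step(1)]
    have s: "0 \<le> s" using step(1) by (simp add: disc_joins_def)
    have "disc_chain \<Omega> \<delta> x w (s + t)" using step disc_chain.step by blast
    note far_x = near[OF this step.prems]
    have xy: "connected_component (\<Omega> \<inter> U) x y" "kobayashi_comp (\<Omega> \<inter> U) x y \<le> C * s"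
      using disc_joins_localize[OF dom assms(2) far_x \<open>0 < R\<close> step(1), of "C * s"]
        C[OF s step(2)] s \<open>0 \<le> C\<close> by auto
    \<comment> \<open>Advancing from \<open>x\<close> to \<open>y\<close> adds at most
      \<open>s\<close> to the first term and removes \<open>s\<close> from the remaining length, so
      the invariant persists.\<close>
    have "kobayashi \<Omega> z y \<le> kobayashi \<Omega> z x + s"
      using kobayashi_triangle[OF dom zw(1), of x y] kobayashi_le[OF dom step(1)] props by simp
    then have "kobayashi \<Omega> z y + t \<le> kobayashi \<Omega> z w + \<epsilon>"
      using step.prems by simp
    then have yw: "connected_component (\<Omega> \<inter> U) y w" "kobayashi_comp (\<Omega> \<inter> U) y w \<le> C * t"
      using step by auto
    define D where "D = connected_component_set (\<Omega> \<inter> U) x"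
    \<comment> \<open>Both partial estimates refer to the same component, where the triangle
      inequality combines them.\<close>
    have D_y: "connected_component_set (\<Omega> \<inter> U) y = D"
      using connected_component_eq[of y "\<Omega> \<inter> U" x] xy(1) by (simp add: D_def)
    have xw: "connected_component (\<Omega> \<inter> U) x w" using xy(1) yw(1) connected_component_trans by blast
    have x: "x \<in> \<Omega> \<inter> U" using connected_component_in xy(1) by blast
    then have "is_domain D" unfolding D_def by (intro is_domain_component op)
    then have "kobayashi D x w \<le> kobayashi D x y + kobayashi D y w"
      by (rule kobayashi_triangle) (use x xy(1) xw in \<open>auto simp: D_def\<close>)
    then show ?case
      using xw xy(2) yw(2) by (simp add: kobayashi_comp_def D_y D_def[symmetric] algebra_simps)
  qed
qed

text \<open>The difference of the two sides vanishes at 0 with slope \<open>C * T - 1 > 0\<close>.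
  This is the point of using short links: the growth factor \<open>C\<close> need only beat
  \<open>1 / T\<close>.\<close>

lemma tanh_le_scaled_tanh:
  fixes C T :: real
  assumes "0 < C * T - 1" "0 < T"
  obtains \<delta> where "0 < \<delta>" "\<And>s. 0 \<le> s \<Longrightarrow> s \<le> \<delta> \<Longrightarrow> tanh s \<le> T * tanh (C * s)"
proof -
  have "((\<lambda>s. T * tanh (C * s) - tanh s) has_real_derivative C * T - 1) (at 0)"
    by (auto intro!: derivative_eq_intros)
  from has_real_derivative_pos_inc_right[OF this assms(1)] obtain d where
    d: "d > 0" "\<And>h. 0 < h \<Longrightarrow> h < d \<Longrightarrow> tanh h < T * tanh (C * h)"
    by auto
  have "tanh s \<le> T * tanh (C * s)" if "0 \<le> s" "s \<le> d / 2" for s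
    using d(2)[of s] d(1) that by (cases "s = 0") auto
  then show ?thesis using that[of "d / 2"] d(1) by simp
qed

text \<open>The link length \<open>\<delta>\<close> depends only on \<open>R\<close> and
  \<open>C\<close>, so chains with excess \<open>\<epsilon>\<close> can be used for every small
  \<open>\<epsilon>\<close>. The margin 1 in \<open>far\<close> absorbs the loss
  \<open>\<epsilon> / 2\<close>.\<close>

lemma kobayashi_comp_le:
  fixes \<Omega> U :: "(complex ^ 'n) set"
  assumes dom: "is_domain \<Omega>" and "open U" and zw: "z \<in> \<Omega>" "w \<in> \<Omega>"
    and far: "\<And>b. b \<in> \<Omega> - U \<Longrightarrow> R + 1 \<le> gromov_product \<Omega> b z w"
    and R: "0 < R" "1 < C * tanh R"
  shows "connected_component (\<Omega> \<inter> U) z w"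
    and "kobayashi_comp (\<Omega> \<inter> U) z w \<le> C * kobayashi \<Omega> z w"
proof -
  have T: "0 < tanh R" using R by simp
  have C: "0 < C" using R(2) T by (smt (verit) zero_less_mult_pos2)
  obtain \<delta> where \<delta>: "0 < \<delta>" "\<And>s. 0 \<le> s \<Longrightarrow> s \<le> \<delta> \<Longrightarrow> tanh s \<le> tanh R * tanh (C * s)"
    using tanh_le_scaled_tanh[of C "tanh R"] R T by auto
  have *: "connected_component (\<Omega> \<inter> U) z w \<and>
      kobayashi_comp (\<Omega> \<inter> U) z w \<le> C * (kobayashi \<Omega> z w + \<epsilon>)" if \<epsilon>: "0 < \<epsilon>" "\<epsilon> \<le> 1" for \<epsilon>
  proof -
    obtain t where t: "disc_chain \<Omega> \<delta> z w t" "t < kobayashi \<Omega> z w + \<epsilon>"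
      using disc_chain_exists[OF dom \<delta>(1) \<epsilon>(1) zw] .
    have "R + \<epsilon> / 2 \<le> gromov_product \<Omega> b z w" if "b \<in> \<Omega> - U" for b
      using far[OF that] \<epsilon> by simp
    then have "connected_component (\<Omega> \<inter> U) z w \<and> kobayashi_comp (\<Omega> \<inter> U) z w \<le> C * t"
      by (rule disc_chain_localize[OF dom assms(2) zw _ R(1) _ \<delta>(2) t(1)])
        (use C t(2) kobayashi_self[OF dom zw(1)] in auto)
    moreover have "C * t \<le> C * (kobayashi \<Omega> z w + \<epsilon>)" using C t(2) by simp
    ultimately show ?thesis by linarith
  qed
  show "connected_component (\<Omega> \<inter> U) z w" using *[of 1] by simp
  show "kobayashi_comp (\<Omega> \<inter> U) z w \<le> C * kobayashi \<Omega> z w"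
  proof (rule field_le_epsilon)
    fix e :: real assume "0 < e"
    \<comment> \<open>The cap 1 respects the margin, and \<open>e / C\<close> makes the total error
      at most \<open>e\<close>.\<close>
    define \<epsilon> where "\<epsilon> = min 1 (e / C)"
    have "0 < \<epsilon>" "\<epsilon> \<le> 1" "C * \<epsilon> \<le> e"
      using \<open>0 < e\<close> C by (auto simp: \<epsilon>_def min_def field_simps)
    then show "kobayashi_comp (\<Omega> \<inter> U) z w \<le> C * kobayashi \<Omega> z w + e"
      using *[of \<epsilon>] by (simp add: algebra_simps)
  qed
qed

section \<open>Passage to the limit at a w-point\<close>

lemma gromov_product_nonneg:
  assumes "is_domain \<Omega>" "b \<in> \<Omega>" "z \<in> \<Omega>" "w \<in> \<Omega>"
  shows "0 \<le> gromov_product \<Omega> b z w"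
  using kobayashi_triangle[OF assms(1), of z b w] kobayashi_commute[OF assms(1), of w b] assms
  by (simp add: gromov_product_def)

text \<open>Nonnegativity of Gromov products bounds the family below, so its infimum is a genuine
  lower bound for each member.\<close>

lemma w_point_eventually:
  assumes "is_domain \<Omega>" "w_point \<Omega> p" "open U" "p \<in> U" "\<Omega> - U \<noteq> {}"
  shows "\<forall>\<^sub>F (z, w) in at (p, p) within \<Omega> \<times> \<Omega>. \<forall>b\<in>\<Omega> - U. M \<le> gromov_product \<Omega> b z w"
proof -
  have "\<forall>\<^sub>F zw in at (p, p) within \<Omega> \<times> \<Omega>.
      M \<le> (case zw of (z, w) \<Rightarrow> INF b\<in>\<Omega> - U. gromov_product \<Omega> b z w)"
    using assms unfolding w_point_def filterlim_at_top by blast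
  moreover have "\<forall>\<^sub>F zw in at (p, p) within \<Omega> \<times> \<Omega>. zw \<in> \<Omega> \<times> \<Omega>"
    by (simp add: eventually_at_filter)
  ultimately show ?thesis
  proof eventually_elim
    case (elim zw)
    obtain z w where zw: "zw = (z, w)" "z \<in> \<Omega>" "w \<in> \<Omega>" using elim by auto
    have "bdd_below ((\<lambda>b. gromov_product \<Omega> b z w) ` (\<Omega> - U))"
      by (rule bdd_belowI[of _ 0]) (use gromov_product_nonneg[OF assms(1)] zw in auto)
    then have "(INF b\<in>\<Omega> - U. gromov_product \<Omega> b z w) \<le> gromov_product \<Omega> b z w" if "b \<in> \<Omega> - U" for b
      using that by (rule cINF_lower)
    with elim show ?case by (force simp: zw)
  qed
qed

theorem theorem3:
  fixes \<Omega> U :: "(complex ^ 'n) set" and p :: "complex ^ 'n"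
  assumes "is_domain \<Omega>"
    and "p \<in> frontier \<Omega>"
    and "w_point \<Omega> p"
    and "open U" and "p \<in> U"
  shows "((\<lambda>(z, w). kobayashi_comp (\<Omega> \<inter> U) z w / kobayashi \<Omega> z w) \<longlongrightarrow> 1)
           (at (p, p) within {(z, w). z \<noteq> w \<and> connected_component (\<Omega> \<inter> U) z w})"
proof -
  define F where "F = at (p, p) within {(z, w). z \<noteq> w \<and> connected_component (\<Omega> \<inter> U) z w}"
  have op: "open \<Omega>" using assms(1) by (simp add: is_domain_def)
  then have p: "p \<notin> \<Omega>" using assms(2) by (simp add: frontier_def interior_open)
  obtain q where q: "q \<in> \<Omega>" using assms(1) by (auto simp: is_domain_def)
  \<comment> \<open>The ball makes \<open>V\<close> bounded and excludes \<open>q\<close>, so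
    \<open>\<Omega> - V\<close> is non-empty even if \<open>\<Omega>\<close> lies in
    \<open>U\<close>. It contains \<open>p\<close> because \<open>p\<close> is not in
    \<open>\<Omega>\<close> and hence differs from \<open>q\<close>.\<close>
  define V where "V = U \<inter> ball p (dist p q)"
  have V: "open V" "p \<in> V" "bounded V" "V \<subseteq> U" and ne: "\<Omega> - V \<noteq> {}"
    using assms(4,5) p q by (auto simp: V_def)
  have sub: "{(z, w). z \<noteq> w \<and> connected_component (\<Omega> \<inter> U) z w} \<subseteq> \<Omega> \<times> \<Omega>"
    using connected_component_in by fastforce
  \<comment> \<open>With \<open>D\<close> and \<open>E\<close> the components of \<open>z\<close> in
    \<open>\<Omega> \<inter> U\<close> and \<open>\<Omega> \<inter> V\<close>, the distances for
    \<open>\<Omega>\<close>, \<open>D\<close>, \<open>E\<close> increase in this order, and the last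
    is at most \<open>C\<close> times the first.\<close>
  have bounds: "\<forall>\<^sub>F (z, w) in F. 1 \<le> kobayashi_comp (\<Omega> \<inter> U) z w / kobayashi \<Omega> z w \<and>
      kobayashi_comp (\<Omega> \<inter> U) z w / kobayashi \<Omega> z w \<le> C" if C: "1 < C" for C
  proof -
    have "((\<lambda>R. C * tanh R) \<longlongrightarrow> C * 1) at_top"
      by (intro tendsto_intros tanh_real_at_top)
    with C have "\<forall>\<^sub>F R in at_top. 1 < C * tanh R" by (auto dest: order_tendstoD(1))
    then have "\<forall>\<^sub>F R in at_top. 0 < R \<and> 1 < C * tanh R"
      using eventually_gt_at_top[of 0] by eventually_elim auto
    then obtain R where R: "0 < R" "1 < C * tanh R"
      using eventually_happens'[OF trivial_limit_at_top_linorder] by blast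
    \<comment> \<open>The limit runs over fewer pairs than in the definition of a w-point, so the
      eventual bound carries over.\<close>
    have "\<forall>\<^sub>F (z, w) in F. \<forall>b\<in>\<Omega> - V. R + 1 \<le> gromov_product \<Omega> b z w"
      unfolding F_def using w_point_eventually[OF assms(1,3) V(1,2) ne]
      by (rule filter_leD[OF at_le[OF sub]])
    moreover have "\<forall>\<^sub>F (z, w) in F. z \<noteq> w \<and> connected_component (\<Omega> \<inter> U) z w"
      by (simp add: F_def eventually_at_filter case_prod_beta)
    ultimately show ?thesis
    proof eventually_elim
      case (elim zw)
      obtain z w where zw: "zw = (z, w)" by fastforce
      have far: "R + 1 \<le> gromov_product \<Omega> b z w" if "b \<in> \<Omega> - V" for b
        using elim(1) that by (simp add: zw)
      have neq: "z \<noteq> w" and con: "connected_component (\<Omega> \<inter> U) z w" using elim(2) by (auto simp: zw)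
      then have z: "z \<in> \<Omega> \<inter> U" "w \<in> \<Omega>" using connected_component_in by blast+
      define D where "D = connected_component_set (\<Omega> \<inter> U) z"
      define E where "E = connected_component_set (\<Omega> \<inter> V) z"
      have le_V: "kobayashi_comp (\<Omega> \<inter> V) z w \<le> C * kobayashi \<Omega> z w"
        and con_V: "connected_component (\<Omega> \<inter> V) z w"
        using kobayashi_comp_le[OF assms(1) V(1) _ z(2) far R] z by auto
      have E: "is_domain E" "bounded E" "z \<in> E" "w \<in> E"
        using con_V connected_component_in[OF con_V] op V
        by (auto simp: E_def intro!: is_domain_component intro: bounded_subset[OF V(3)]
            dest: connected_component_in)
      have D: "is_domain D" "z \<in> D" "w \<in> D" "D \<subseteq> \<Omega>"
        using con op assms(4) z
        by (auto simp: D_def intro!: is_domain_component dest: connected_component_in)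
      have "E \<subseteq> D" unfolding D_def E_def by (rule connected_component_mono) (use V in auto)
      then have "kobayashi D z w \<le> kobayashi E z w"
        using kobayashi_antimono E D by blast
      moreover have "0 < kobayashi E z w" using kobayashi_pos E neq by blast
      moreover have "kobayashi \<Omega> z w \<le> kobayashi D z w"
        using kobayashi_antimono D assms(1) by blast
      \<comment> \<open>Positivity on the bounded domain \<open>E\<close> transfers to
        \<open>\<Omega>\<close> through \<open>le_V\<close>, which makes the quotient
        meaningful.\<close>
      moreover have "0 < kobayashi \<Omega> z w"
      proof -
        have "0 < C * kobayashi \<Omega> z w"
          using le_V calculation(2) by (simp add: kobayashi_comp_def E_def)
        then show ?thesis using C by (simp add: zero_less_mult_iff)
      qed
      ultimately show ?case
        using le_V by (simp add: zw kobayashi_comp_def D_def[symmetric] E_def[symmetric] field_simps)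
    qed
  qed
  have "((\<lambda>(z, w). kobayashi_comp (\<Omega> \<inter> U) z w / kobayashi \<Omega> z w) \<longlongrightarrow> 1) F"
  proof (rule order_tendstoI)
    fix a :: real assume "a < 1"
    \<comment> \<open>The lower bound 1 is the same for every \<open>C > 1\<close>; the value 2 is
      arbitrary.\<close>
    show "\<forall>\<^sub>F x in F. a < (case x of (z, w) \<Rightarrow> kobayashi_comp (\<Omega> \<inter> U) z w / kobayashi \<Omega> z w)"
      using bounds[of 2] by (rule eventually_mono) (use \<open>a < 1\<close> in auto)
  next
    fix a :: real assume "1 < a"
    then obtain C where "1 < C" "C < a" using dense by blast
    show "\<forall>\<^sub>F x in F. (case x of (z, w) \<Rightarrow> kobayashi_comp (\<Omega> \<inter> U) z w / kobayashi \<Omega> z w) < a"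
      using bounds[OF \<open>1 < C\<close>] by (rule eventually_mono) (use \<open>C < a\<close> in auto)
  qed
  then show ?thesis by (simp add: F_def)
qed

end
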